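(* Let $(X,\|\cdot,\cdot\|)$ be a linear $2$-normed space, let $G\subset X$, and let $W$ be a nonempty bounded subset of $X$. Let $g^{*}\in G$ and let $b\in X$ be such that $b\notin L\{f,g^{*}\}$ for every $f\in W$. Then $$\Phi(g,b)=\sup_{f_1,f_2\in W}\max\bigl\{\|f_1-g,b\|,\ \|f_2-g,b\|\bigr\}$$ is, as a function of $g$, a continuous functional on $X$.
   Context: A linear 2-normed space is a linear space $X$ over $F$ ($F=\mathbb{R}$ or $\mathbb{C}$), with $\dim X>1$, together with a function $\|\cdot,\cdot\|:X\times X\to[0,\infty)$ such that: (N1) $\|x,y\|=0$ if and only if $x$ and $y$ are linearly dependent; (N2) $\|x,y\|=\|y,x\|$; (N3) $\|\alpha x,y\|=|\alpha|\,\|x,y\|$ for all scalars $\alpha$; (N4) $\|x+y,z\|\le\|x,z\|+\|y,z\|$, for all $x,y,z\in X$. For each $c\in X$, $p_c(x)=\|x,c\|$ is a seminorm on $X$, and $X$ carries the locally convex topology generated by the family $\{p_c:c\in X\}$; continuity on $X$ refers to this topology. A subset $W\subset X$ is bounded if $\sup_{f\in W}\|f,c\|<\infty$ for every $c\in X$. $L\{f,g^{*}\}$ denotes the linear subspace of $X$ generated by $f$ and $g^{*}$. *)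

theory Defs
  imports "HOL-Analysis.Analysis"
begin

(* Dependence of the family (x, y), not of the set {x, y}: for x = y \<noteq> 0 the set
   collapses to the independent set {x}, whereas the pair is dependent. *)
definition lin_dependent_pair ::
    "('f::field \<Rightarrow> 'a::ab_group_add \<Rightarrow> 'a) \<Rightarrow> 'a \<Rightarrow> 'a \<Rightarrow> bool" where
  "lin_dependent_pair smul x y \<longleftrightarrow>
     (\<exists>\<alpha> \<beta>. (\<alpha> \<noteq> 0 \<or> \<beta> \<noteq> 0) \<and> smul \<alpha> x + smul \<beta> y = 0)"

(* The scalar types real and complex are both instances of real_normed_field; by the
   Gelfand-Mazur theorem these are, up to isometric isomorphism, its only instances.
   dim_gt_1 is phrased with a basis because the library's dim is 0 in infinite dimension. *)
locale two_normed_space = vector_space smul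
  for smul :: "'f::real_normed_field \<Rightarrow> 'a::ab_group_add \<Rightarrow> 'a" +
  fixes N :: "'a \<Rightarrow> 'a \<Rightarrow> real"
  assumes dim_gt_1: "\<exists>B. independent B \<and> span B = UNIV \<and> (infinite B \<or> card B > 1)"
    and N_nonneg: "N x y \<ge> 0"
    and N1: "N x y = 0 \<longleftrightarrow> lin_dependent_pair smul x y"
    and N2: "N x y = N y x"
    and N3: "N (smul \<alpha> x) y = norm \<alpha> * N x y"
    and N4: "N (x + y) z \<le> N x z + N y z"

(* The balls of the single seminorms p_c = N _ c form a subbase; finite intersections
   account for finitely many c at once. *)
definition two_norm_topology :: "('a::ab_group_add \<Rightarrow> 'a \<Rightarrow> real) \<Rightarrow> 'a topology" where
  "two_norm_topology N =
     topology_generated_by {{x. N (x - a) c < \<epsilon>} |a c \<epsilon>. \<epsilon> > 0}"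

definition two_norm_bounded :: "('a \<Rightarrow> 'a \<Rightarrow> real) \<Rightarrow> 'a set \<Rightarrow> bool" where
  "two_norm_bounded N W \<longleftrightarrow> (\<forall>c. bdd_above ((\<lambda>f. N f c) ` W))"

definition Phi :: "('a::ab_group_add \<Rightarrow> 'a \<Rightarrow> real) \<Rightarrow> 'a set \<Rightarrow> 'a \<Rightarrow> 'a \<Rightarrow> real" where
  "Phi N W g b = (SUP (f\<^sub>1, f\<^sub>2) \<in> W \<times> W. max (N (f\<^sub>1 - g) b) (N (f\<^sub>2 - g) b))"

end

theory Submission
  imports Defs
begin

text \<open>
  Only the single seminorm \<open>p\<^sub>b = N _ b\<close> matters. For fixed \<open>f\<^sub>1\<close> and \<open>f\<^sub>2\<close>, the triangle inequality
  shows that replacing \<open>g\<close> by \<open>h\<close> changes the maximum of \<open>p\<^sub>b (f\<^sub>1 - g)\<close> and \<open>p\<^sub>b (f\<^sub>2 - g)\<close> by at most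
  \<open>p\<^sub>b (g - h)\<close>. This bound is uniform in \<open>f\<^sub>1\<close> and \<open>f\<^sub>2\<close>, so it survives the supremum, which is finite
  because \<open>W\<close> is bounded (lemma \<open>Phi_le_Phi_plus\<close>). Hence \<open>\<Phi>(_, b)\<close> is \<open>1\<close>-Lipschitz for \<open>p\<^sub>b\<close>, and a
  function that is \<open>1\<close>-Lipschitz for one of the generating seminorms is continuous
  (lemma \<open>continuous_map_two_norm_Lipschitz\<close>).
\<close>

context two_normed_space
begin

lemma N_zero_left: "N 0 c = 0"
  using N3[of 0 0 c] by simp

lemma N_minus_left: "N (- x) c = N x c"
  using N3[of "- 1" x c] by simp

lemma N_minus_commute: "N (x - y) c = N (y - x) c"
  using N_minus_left[of "x - y" c] by simp

lemma N_diff_triangle: "N (x - z) c \<le> N (x - y) c + N (y - z) c"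
  using N4[of "x - y" "y - z" c] by simp

lemma openin_two_norm_ball:
  "\<epsilon> > 0 \<Longrightarrow> openin (two_norm_topology N) {x. N (x - a) c < \<epsilon>}"
  unfolding two_norm_topology_def by (rule topology_generated_by_Basis) blast

lemma topspace_two_norm: "topspace (two_norm_topology N) = UNIV"
proof -
  \<comment> \<open>Every point is the centre of a ball, since \<open>N 0 c = 0\<close>.\<close>
  have "x \<in> topspace (two_norm_topology N)" for x
    using openin_subset[OF openin_two_norm_ball[of 1 x 0]] by (auto simp: N_zero_left)
  then show ?thesis by blast
qed

text \<open>
  The \<open>p\<^sub>c\<close>-ball of radius \<open>\<epsilon>\<close> around \<open>x\<close> is mapped into the \<open>\<epsilon>\<close>-ball around \<open>\<phi> x\<close>, so preimages of
  open sets contain a ball around each of their points. By the symmetry of \<open>p\<^sub>c\<close>, the one-sided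
  estimate for all pairs already bounds the absolute difference.
\<close>
lemma continuous_map_two_norm_Lipschitz:
  assumes lip: "\<And>x y. \<phi> x \<le> \<phi> y + N (x - y) c"
  shows "continuous_map (two_norm_topology N) euclideanreal \<phi>"
proof -
  have "openin (two_norm_topology N) {x. \<phi> x \<in> U}" if "open U" for U
  proof (subst openin_subopen, intro ballI)
    fix x assume "x \<in> {x. \<phi> x \<in> U}"
    then obtain \<epsilon> where "\<epsilon> > 0" and sub: "ball (\<phi> x) \<epsilon> \<subseteq> U"
      using \<open>open U\<close> open_contains_ball by blast
    have "\<phi> y \<in> U" if "N (y - x) c < \<epsilon>" for y
    proof -
      have "\<bar>\<phi> x - \<phi> y\<bar> < \<epsilon>"
        using lip[of x y] lip[of y x] that by (simp add: N_minus_commute[of x y])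
      then show ?thesis using sub by (auto simp: dist_real_def)
    qed
    then show "\<exists>T. openin (two_norm_topology N) T \<and> x \<in> T \<and> T \<subseteq> {x. \<phi> x \<in> U}"
      using \<open>\<epsilon> > 0\<close> openin_two_norm_ball[of \<epsilon> x c]
      by (intro exI[of _ "{y. N (y - x) c < \<epsilon>}"]) (auto simp: N_zero_left)
  qed
  then show ?thesis
    by (simp add: continuous_map_def topspace_two_norm)
qed

text \<open>
  Boundedness is what makes the supremum an honest least upper bound: in the reals, \<open>Sup\<close> of an
  unbounded set is an unspecified value, for which no estimate is available.
\<close>
lemma bdd_above_Phi:
  assumes "two_norm_bounded N W"
  shows "bdd_above ((\<lambda>(f\<^sub>1, f\<^sub>2). max (N (f\<^sub>1 - g) b) (N (f\<^sub>2 - g) b)) ` (W \<times> W))"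
proof -
  obtain M where M: "\<And>f. f \<in> W \<Longrightarrow> N f b \<le> M"
    using assms unfolding two_norm_bounded_def bdd_above_def by blast
  have "N (f - g) b \<le> M + N g b" if "f \<in> W" for f
    using M[OF that] N_diff_triangle[of f g b 0] by (simp add: N_minus_left)
  then show ?thesis
    by (intro bdd_aboveI[of _ "M + N g b"]) auto
qed

lemma Phi_le_Phi_plus:
  assumes "W \<noteq> {}" and "two_norm_bounded N W"
  shows "Phi N W g b \<le> Phi N W h b + N (g - h) b"
  unfolding Phi_def
proof (rule cSUP_least)
  show "W \<times> W \<noteq> {}" using assms(1) by simp
next
  fix p assume p: "p \<in> W \<times> W"
  obtain f\<^sub>1 f\<^sub>2 where p_eq: "p = (f\<^sub>1, f\<^sub>2)" by (cases p)
  have "max (N (f\<^sub>1 - g) b) (N (f\<^sub>2 - g) b)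
        \<le> max (N (f\<^sub>1 - h) b) (N (f\<^sub>2 - h) b) + N (g - h) b"
    using N_diff_triangle[of f\<^sub>1 g b h] N_diff_triangle[of f\<^sub>2 g b h]
    unfolding N_minus_commute[of h g] by (simp add: max_def)
  also have "max (N (f\<^sub>1 - h) b) (N (f\<^sub>2 - h) b)
        \<le> (SUP (f\<^sub>1, f\<^sub>2) \<in> W \<times> W. max (N (f\<^sub>1 - h) b) (N (f\<^sub>2 - h) b))"
    using cSUP_upper[OF p bdd_above_Phi[OF assms(2), of h b]] by (simp add: p_eq)
  finally show "(case p of (f\<^sub>1, f\<^sub>2) \<Rightarrow> max (N (f\<^sub>1 - g) b) (N (f\<^sub>2 - g) b))
      \<le> (SUP (f\<^sub>1, f\<^sub>2) \<in> W \<times> W. max (N (f\<^sub>1 - h) b) (N (f\<^sub>2 - h) b)) + N (g - h) b"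
    by (simp add: p_eq)
qed

end

theorem lemma2:
  fixes smul :: "'f::real_normed_field \<Rightarrow> 'a::ab_group_add \<Rightarrow> 'a"
    and N :: "'a \<Rightarrow> 'a \<Rightarrow> real"
    and G W :: "'a set"
    and gstar b :: 'a
  assumes "two_normed_space smul N"
    and "W \<noteq> {}"
    and "two_norm_bounded N W"
    and "gstar \<in> G"
    and "\<forall>f\<in>W. b \<notin> module.span smul {f, gstar}"
  shows "continuous_map (two_norm_topology N) euclideanreal (\<lambda>g. Phi N W g b)"
proof -
  interpret two_normed_space smul N by fact
  show ?thesis
    by (rule continuous_map_two_norm_Lipschitz) (rule Phi_le_Phi_plus[OF assms(2,3)])
qed

end
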